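(* Let $p>q>1$ be coprime integers. Then the subshift $\Xi_{p/q}$ is not sofic. In particular, the cellular automaton $\Pi_{p/q,pq}$ is not regular.
   Context: For $n\ge 2$ let $\Sigma_n=\{0,1,\dots,n-1\}$. For a finite alphabet $A$, $A^{\mathbb{Z}}$ carries the product topology, and $\sigma(x)[i]=x[i+1]$ is the shift map. A subshift is a nonempty closed $X\subseteq A^{\mathbb{Z}}$ with $\sigma(X)=X$, regarded as the dynamical system $(X,\sigma)$. Its language $L(X)\subseteq A^*$ is the set of all finite words occurring as subwords of elements of $X$. A subshift $X$ is sofic if $L(X)$ is a regular language. A cellular automaton $F:X\to X$ is regular if every subshift factor of $(X,F)$ is sofic, where a subshift factor is a subshift $(Z,\sigma)$ for which there is a continuous surjection $\psi:X\to Z$ with $\psi\circ F=\sigma\circ\psi$. For coprime integers $s,t>1$, write $a,b\in\Sigma_{st}$ uniquely as $a=a_1t+a_0$, $b=b_1t+b_0$ with $a_0,b_0\in\Sigma_t$, $a_1,b_1\in\Sigma_s$, and put $g_{s,st}(a,b)=a_0s+b_1$. Let $f_{s/t,st}(a,c,b)=g_{s,st}(g_{s,st}(a,c),g_{s,st}(c,b))$. The multiplication automaton $\Pi_{s/t,st}:\Sigma_{st}^{\mathbb{Z}}\to\Sigma_{st}^{\mathbb{Z}}$ is $\Pi_{s/t,st}(x)[i]=f_{s/t,st}(x[i-1],x[i],x[i+1])$; it is a bijection with inverse $\Pi_{t/s,st}$ and it multiplies by $s/t$ in base $st$. The trace of $x\in\Sigma_{st}^{\mathbb{Z}}$ is $\mathrm{Tr}_{s/t}(x)\in\Sigma_{st}^{\mathbb{Z}}$,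 $\mathrm{Tr}_{s/t}(x)[k]=\Pi_{s/t,st}^k(x)[0]$ for $k\in\mathbb{Z}$, and the trace subshift is $\Xi_{s/t}=\mathrm{Tr}_{s/t}(\Sigma_{st}^{\mathbb{Z}})$. *)

theory Defs
  imports "HOL-Analysis.Analysis"
begin

section \<open>Subshifts and sofic shifts\<close>

definition digits :: "nat \<Rightarrow> nat set" where
  "digits n = {0..<n}"

definition full_shift :: "'a set \<Rightarrow> (int \<Rightarrow> 'a) set" where
  "full_shift A = {x. \<forall>i. x i \<in> A}"

definition shift :: "(int \<Rightarrow> 'a) \<Rightarrow> (int \<Rightarrow> 'a)" where
  "shift x = (\<lambda>i. x (i + 1))"

text \<open>
  The topology on \<^typ>\<open>int \<Rightarrow> 'a\<close> is the product of the discrete topologies on \<^typ>\<open>'a\<close>; it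
  induces the product topology on the closed set \<^term>\<open>full_shift A\<close>, so that being closed in
  \<^typ>\<open>int \<Rightarrow> 'a\<close> and being closed in \<^term>\<open>full_shift A\<close> coincide for subsets of the latter.
\<close>

definition subshift :: "'a::discrete_topology set \<Rightarrow> (int \<Rightarrow> 'a) set \<Rightarrow> bool" where
  "subshift A X \<longleftrightarrow>
     finite A \<and> X \<noteq> {} \<and> X \<subseteq> full_shift A \<and> closed X \<and> shift ` X = X"

definition language :: "(int \<Rightarrow> 'a) set \<Rightarrow> 'a list set" where
  "language X = {map (\<lambda>j. x (i + int j)) [0..<n] | x i n. x \<in> X}"

text \<open>
  Acceptance by a deterministic finite automaton with input alphabet \<^term>\<open>A\<close>. Taking natural
  numbers as states is no restriction, because the state set is finite.
\<close>

definition regular_language :: "'a set \<Rightarrow> 'a list set \<Rightarrow> bool" where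
  "regular_language A L \<longleftrightarrow>
     (\<exists>(Q :: nat set) \<delta> q\<^sub>0 F.
        finite Q \<and> q\<^sub>0 \<in> Q \<and> F \<subseteq> Q \<and> (\<forall>q\<in>Q. \<forall>a\<in>A. \<delta> q a \<in> Q) \<and>
        L = {w \<in> lists A. foldl \<delta> q\<^sub>0 w \<in> F})"

definition sofic :: "'a set \<Rightarrow> (int \<Rightarrow> 'a) set \<Rightarrow> bool" where
  "sofic A X \<longleftrightarrow> regular_language A (language X)"

section \<open>Subshift factors and regular cellular automata\<close>

definition subshift_factor ::
  "(int \<Rightarrow> 'a::discrete_topology) set \<Rightarrow> ((int \<Rightarrow> 'a) \<Rightarrow> (int \<Rightarrow> 'a)) \<Rightarrow>
   'b::discrete_topology set \<Rightarrow> (int \<Rightarrow> 'b) set \<Rightarrow> bool" where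
  "subshift_factor X F B Z \<longleftrightarrow>
     subshift B Z \<and>
     (\<exists>\<psi>. continuous_on X \<psi> \<and> \<psi> ` X = Z \<and> (\<forall>x\<in>X. \<psi> (F x) = shift (\<psi> x)))"

text \<open>
  Every finite alphabet is in bijection with a finite set of natural numbers, and renaming symbols
  preserves both being a factor and being sofic. So factors over alphabets \<^term>\<open>B :: nat set\<close>
  represent all subshift factors.
\<close>

definition regular_CA ::
  "(int \<Rightarrow> 'a::discrete_topology) set \<Rightarrow> ((int \<Rightarrow> 'a) \<Rightarrow> (int \<Rightarrow> 'a)) \<Rightarrow> bool" where
  "regular_CA X F \<longleftrightarrow> (\<forall>(B :: nat set) Z. subshift_factor X F B Z \<longrightarrow> sofic B Z)"

section \<open>Multiplication automata and their traces\<close>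

text \<open>
  For \<open>a = a\<^sub>1 * t + a\<^sub>0\<close> with \<open>a\<^sub>0 < t\<close>, one has \<open>a\<^sub>0 = a mod t\<close> and \<open>a\<^sub>1 = a div t\<close>.
  In the following three definitions the base is \<open>s * t\<close>.
\<close>

definition mult_g :: "nat \<Rightarrow> nat \<Rightarrow> nat \<Rightarrow> nat \<Rightarrow> nat" where
  "mult_g s t a b = (a mod t) * s + b div t"

definition mult_f :: "nat \<Rightarrow> nat \<Rightarrow> nat \<Rightarrow> nat \<Rightarrow> nat \<Rightarrow> nat" where
  "mult_f s t a c b = mult_g s t (mult_g s t a c) (mult_g s t c b)"

definition mult_automaton :: "nat \<Rightarrow> nat \<Rightarrow> (int \<Rightarrow> nat) \<Rightarrow> (int \<Rightarrow> nat)" where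
  "mult_automaton s t x = (\<lambda>i. mult_f s t (x (i - 1)) (x i) (x (i + 1)))"

definition int_iterate :: "'c set \<Rightarrow> ('c \<Rightarrow> 'c) \<Rightarrow> int \<Rightarrow> 'c \<Rightarrow> 'c" where
  "int_iterate X F k = (if 0 \<le> k then F ^^ nat k else inv_into X F ^^ nat (- k))"

definition mult_trace :: "nat \<Rightarrow> nat \<Rightarrow> (int \<Rightarrow> nat) \<Rightarrow> (int \<Rightarrow> nat)" where
  "mult_trace s t x =
     (\<lambda>k. int_iterate (full_shift (digits (s * t))) (mult_automaton s t) k x 0)"

definition trace_subshift :: "nat \<Rightarrow> nat \<Rightarrow> (int \<Rightarrow> nat) set" where
  "trace_subshift s t = mult_trace s t ` full_shift (digits (s * t))"

end

theory Submission
  imports Defs "HOL-Number_Theory.Cong"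
begin

text \<open>
  Put \<open>n = p * q\<close> and \<open>v(x) = (\<Sum>i\<ge>1. x[i] / n^i) \<in> [0,1]\<close>. One step of the automaton satisfies
  \<open>q * v(\<Pi> x) = p * v(x) - e\<close>, where the integer carry \<open>e\<close> is determined by \<open>x[0]\<close> and
  \<open>(\<Pi> x)[0]\<close>, that is, by two consecutive letters of the trace. Hence, if two configurations show
  the same trace for a while, the difference of their fractional parts is multiplied by \<open>p / q\<close> at
  each step; in particular it keeps its sign, and it cannot stay nonzero for long.

  Let \<open>T\<close> be the trace of the expansion of the number \<open>1\<close>, and let \<open>f\<^sub>k\<close> be the fractional part of
  \<open>(p/q)^k\<close>. The \<open>f\<^sub>k\<close> are pairwise distinct because their reduced denominators are \<open>q^k\<close>. Since
  \<open>f\<^sub>0 = 0\<close>, every occurrence of \<open>T[0..j]\<close> in a trace ends at a fractional part \<open>\<ge> f\<^sub>j\<close>. If a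
  finite automaton identifies \<open>T[0..i]\<close> and \<open>T[0..j]\<close>, where \<open>f\<^sub>i < f\<^sub>j\<close> and \<open>T[i] = T[j]\<close>, then
  \<open>T[0..j]\<close> can be followed by arbitrarily long continuations of \<open>T[0..i]\<close>. Then the gap between
  \<open>f\<^sub>i\<close> and a fractional part \<open>\<ge> f\<^sub>j\<close> expands beyond \<open>1\<close>, a contradiction.
\<close>

section \<open>The automaton as a square of a one-sided automaton\<close>

text \<open>With digit \<open>i\<close> read at weight \<open>n^(-i)\<close>,
  \<open>n = s * t\<close>, this is multiplication by \<open>s\<close> in base \<open>n\<close>. Two
  such steps and a right shift, a division by \<open>n\<close>, give
  \<open>s * s / n = s / t\<close>.\<close>

definition mult_step :: "nat \<Rightarrow> nat \<Rightarrow> (int \<Rightarrow> nat) \<Rightarrow> (int \<Rightarrow> nat)" where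
  "mult_step s t x = (\<lambda>i. mult_g s t (x i) (x (i + 1)))"

lemma mult_automaton_eq_mult_step:
  "mult_automaton s t x i = mult_step s t (mult_step s t x) (i - 1)"
  by (simp add: mult_automaton_def mult_step_def mult_f_def add.commute)

lemma full_shift_digits_iff: "x \<in> full_shift (digits n) \<longleftrightarrow> (\<forall>i. x i < n)"
  by (auto simp: full_shift_def digits_def)

lemma mult_g_less:
  assumes "a < s * t" "b < s * t"
  shows "mult_g s t a b < s * t"
proof -
  have t: "t > 0" using assms by (cases t) auto
  have b: "b div t < s" using assms by (simp add: less_mult_imp_div_less)
  have "(a mod t) * s + b div t < (a mod t + 1) * s" using b by simp
  also have "\<dots> \<le> t * s" using t by (intro mult_right_mono) (auto simp: Suc_le_eq)
  finally show ?thesis by (simp add: mult_g_def mult.commute)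
qed

lemma mult_step_full_shift:
  assumes "x \<in> full_shift (digits (s * t))"
  shows "mult_step s t x \<in> full_shift (digits (s * t))"
  using assms by (auto simp: full_shift_digits_iff mult_step_def intro!: mult_g_less)

lemma mult_automaton_full_shift:
  assumes "x \<in> full_shift (digits (s * t))"
  shows "mult_automaton s t x \<in> full_shift (digits (s * t))"
  using mult_step_full_shift[OF mult_step_full_shift[OF assms]]
  by (auto simp: full_shift_digits_iff mult_automaton_eq_mult_step)

text \<open>Multiplying by \<open>s\<close> and then by \<open>t\<close> multiplies by the base, a
  left shift. Digit \<open>j\<close> of \<open>mult_step s t x\<close> has quotient
  \<open>x j mod t\<close> and remainder \<open>x (j + 1) div t\<close> modulo \<open>s\<close>; the
  second step reassembles these parts.\<close>

lemma mult_step_swap: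
  assumes "x \<in> full_shift (digits (s * t))"
  shows "mult_step t s (mult_step s t x) i = x (i + 1)"
proof -
  have d: "x j div t < s" for j
    using assms by (simp add: full_shift_digits_iff less_mult_imp_div_less)
  then have s: "s > 0" by (metis gr_zeroI not_less_zero)
  have "mult_step s t x j mod s = x (j + 1) div t" "mult_step s t x j div s = x j mod t" for j
    using d[of "j + 1"] s by (simp_all add: mult_step_def mult_g_def)
  then show ?thesis
    by (simp add: mult_step_def[of t s] mult_g_def div_mult_mod_eq)
qed

lemma mult_step_shift: "mult_step s t (\<lambda>i. x (i + c)) = (\<lambda>i. mult_step s t x (i + c))"
  by (simp add: mult_step_def add.commute add.left_commute)

lemma mult_automaton_inverse:
  assumes x: "x \<in> full_shift (digits (s * t))"
  shows "mult_automaton t s (mult_automaton s t x) = x"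
proof
  fix i
  let ?y = "mult_step s t x"
  have "mult_automaton s t x = (\<lambda>i. mult_step s t ?y (i + (- 1)))"
    by (simp add: fun_eq_iff mult_automaton_eq_mult_step)
  \<comment> \<open>Both right shifts are moved outward; two uses of the swap rule then supply the
    left shifts that undo them.\<close>
  then have "mult_automaton t s (mult_automaton s t x) i
      = mult_step t s (mult_step t s (mult_step s t ?y)) (i - 2)"
    by (simp only: mult_automaton_eq_mult_step mult_step_shift) simp
  also have "mult_step t s (mult_step s t ?y) = (\<lambda>i. ?y (i + 1))"
    using mult_step_swap[OF mult_step_full_shift[OF x]] by auto
  also have "mult_step t s \<dots> (i - 2) = x i"
    using mult_step_swap[OF x] by (simp add: mult_step_shift)
  finally show "mult_automaton t s (mult_automaton s t x) i = x i" .
qed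

lemma mult_automaton_inverse':
  assumes "x \<in> full_shift (digits (s * t))"
  shows "mult_automaton s t (mult_automaton t s x) = x"
  using mult_automaton_inverse[of x t s] assms by (simp add: mult.commute)

lemma mult_automaton_bij:
  "bij_betw (mult_automaton s t) (full_shift (digits (s * t))) (full_shift (digits (s * t)))"
  using mult_automaton_full_shift[of _ s t] mult_automaton_full_shift[of _ t s]
  by (intro bij_betw_byWitness[where f' = "mult_automaton t s"])
     (auto simp: mult_automaton_inverse mult_automaton_inverse' mult.commute)

text \<open>Replaces the chosen inverse in \<open>int_iterate\<close> by a local rule, which gives
  continuity of the negative iterates.\<close>

lemma inv_into_mult_automaton:
  assumes "x \<in> full_shift (digits (s * t))"
  shows "inv_into (full_shift (digits (s * t))) (mult_automaton s t) x = mult_automaton t s x"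
  using assms mult_automaton_full_shift[of x t s] mult_automaton_inverse'[OF assms]
  by (intro inv_into_f_eq) (auto simp: mult.commute bij_betw_imp_inj_on[OF mult_automaton_bij])

section \<open>Integer iterates\<close>

lemma int_iterate_closed:
  assumes "bij_betw F X X" "x \<in> X"
  shows "int_iterate X F k x \<in> X"
proof -
  have "G ` X \<subseteq> X \<Longrightarrow> (G ^^ m) x \<in> X" for G m
    using assms(2) by (induction m) auto
  then show ?thesis
    using assms(1) bij_betw_inv_into[OF assms(1)]
    by (simp add: int_iterate_def bij_betw_def)
qed

lemma int_iterate_succ:
  assumes "bij_betw F X X" "x \<in> X"
  shows "int_iterate X F (k + 1) x = F (int_iterate X F k x)"
proof (cases "k \<ge> 0")
  case True
  then show ?thesis by (simp add: int_iterate_def nat_add_distrib)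
next
  case False
  define m where "m = nat (- (k + 1))"
  have nat: "nat (- k) = Suc m" using False by (simp add: m_def)
  \<comment> \<open>For \<open>k = - 1\<close> the index \<open>k + 1 = 0\<close> falls into the
    nonnegative branch of \<open>int_iterate\<close>.\<close>
  have "(inv_into X F ^^ m) x = int_iterate X F (k + 1) x"
    using False by (cases "k = - 1") (auto simp: int_iterate_def m_def)
  then have "(inv_into X F ^^ m) x \<in> F ` X"
    using int_iterate_closed[OF assms] assms(1) by (simp add: bij_betw_def)
  then have "F (inv_into X F ((inv_into X F ^^ m) x)) = (inv_into X F ^^ m) x"
    by (rule f_inv_into_f)
  moreover have "int_iterate X F k x = inv_into X F ((inv_into X F ^^ m) x)"
    using False nat by (simp add: int_iterate_def)
  ultimately show ?thesis
    using \<open>(inv_into X F ^^ m) x = int_iterate X F (k + 1) x\<close> by simp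
qed

lemma int_iterate_add_nat:
  assumes "bij_betw F X X" "x \<in> X"
  shows "int_iterate X F (k + int m) x = (F ^^ m) (int_iterate X F k x)"
proof (induction m)
  case (Suc m)
  then show ?case
    using int_iterate_succ[OF assms, of "k + int m"] by (simp add: algebra_simps)
qed simp

lemma int_iterate_commute:
  assumes "bij_betw F X X" "x \<in> X"
  shows "int_iterate X F k (F x) = F (int_iterate X F k x)"
proof (cases "k \<ge> 0")
  case True
  then show ?thesis by (simp add: int_iterate_def funpow_swap1)
next
  case False
  have "(inv_into X F ^^ m) (F x) = F ((inv_into X F ^^ m) x) \<and> (inv_into X F ^^ m) x \<in> X" for m
  proof (induction m)
    case (Suc m)
    let ?y = "(inv_into X F ^^ m) x"
    have "?y \<in> F ` X" using Suc assms(1) by (simp add: bij_betw_def)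
    then show ?case
      using Suc assms(1) by (simp add: bij_betw_def f_inv_into_f inv_into_into)
  qed (use assms in simp)
  then show ?thesis using False by (simp add: int_iterate_def)
qed

text \<open>The configuration at time \<open>i\<close> is again in the full shift, so windows of a
  trace may be assumed to start at time 0.\<close>

lemma mult_trace_window:
  assumes "x \<in> full_shift (digits (s * t))"
  obtains y where "y \<in> full_shift (digits (s * t))"
    "\<And>k. mult_trace s t x (i + int k) = (mult_automaton s t ^^ k) y 0"
  using that[OF int_iterate_closed[OF mult_automaton_bij assms, of i]]
    int_iterate_add_nat[OF mult_automaton_bij assms, of i]
  by (simp add: mult_trace_def)

section \<open>Fractional parts and carries\<close>

text \<open>The value 1 is attained when all digits after the point are \<open>n - 1\<close>, so
  this differs from the usual fractional part.\<close>

definition frac_value :: "nat \<Rightarrow> (int \<Rightarrow> nat) \<Rightarrow> real" where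
  "frac_value n x = (\<Sum>i. real (x (int i + 1)) / real n ^ (i + 1))"

text \<open>Multiplying by \<open>s\<close> pushes \<open>x 1 div t\<close> leftward across the
  point; dividing by \<open>t\<close> brings \<open>mult_step s t x 0 mod t\<close> back. The carry
  is the net loss of the fractional part.\<close>

definition mult_carry :: "nat \<Rightarrow> nat \<Rightarrow> (int \<Rightarrow> nat) \<Rightarrow> int" where
  "mult_carry s t x = int (x 1 div t) - int (mult_step s t x 0 mod t)"

section \<open>Convergence and range of the fractional value\<close>

lemma summable_bounded_digits:
  fixes c :: "nat \<Rightarrow> real"
  assumes "n > 1" "\<And>i. 0 \<le> c i" "\<And>i. c i \<le> K"
  shows "summable (\<lambda>i. c i / real n ^ i)"
proof (rule summable_comparison_test')
  show "summable (\<lambda>i. K * (1 / real n) ^ i)"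
    using assms(1) by (intro summable_mult summable_geometric) simp
  show "norm (c i / real n ^ i) \<le> K * (1 / real n) ^ i" if "i \<ge> 0" for i
    using assms by (simp add: power_one_over divide_right_mono field_simps)
qed

lemma summable_frac_value:
  assumes "x \<in> full_shift (digits n)" "n > 1"
  shows "summable (\<lambda>i. real (x (int i + 1)) / real n ^ (i + 1))"
proof -
  have "summable (\<lambda>i. real (x (int i + 1)) / real n / real n ^ i)"
    using assms
    by (intro summable_bounded_digits[where K = 1]) (auto simp: full_shift_digits_iff less_imp_le)
  then show ?thesis by (simp add: mult.commute)
qed

lemma frac_value_nonneg:
  assumes "x \<in> full_shift (digits n)" "n > 1"
  shows "frac_value n x \<ge> 0"
  unfolding frac_value_def by (intro suminf_nonneg summable_frac_value assms) simp

lemma frac_value_le_1: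
  assumes x: "x \<in> full_shift (digits n)" and n: "n > 1"
  shows "frac_value n x \<le> 1"
proof -
  let ?g = "\<lambda>i. real (n - 1) / real n * (1 / real n) ^ i"
  have g: "?g sums (real (n - 1) / real n * (1 / (1 - 1 / real n)))"
    using n by (intro sums_mult geometric_sums) simp
  have "frac_value n x \<le> suminf ?g"
    unfolding frac_value_def
  proof (intro suminf_le summable_frac_value x n)
    show "summable ?g" using g by (rule sums_summable)
    fix i
    have "x (int i + 1) \<le> n - 1"
      using x n by (simp add: full_shift_digits_iff) (metis Suc_pred less_Suc_eq_le not_less_zero gr_zeroI)
    then have "real (x (int i + 1)) / real n ^ (i + 1) \<le> real (n - 1) / real n ^ (i + 1)"
      by (intro divide_right_mono) auto
    then show "real (x (int i + 1)) / real n ^ (i + 1) \<le> ?g i"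
      by (simp add: power_one_over)
  qed
  also have "suminf ?g = 1"
    using sums_unique[OF g] n by (simp add: field_simps of_nat_diff)
  finally show ?thesis .
qed

section \<open>Effect of the automaton on the fractional value\<close>

lemma frac_value_mult_step:
  assumes x: "x \<in> full_shift (digits (s * t))" and n: "s * t > 1"
  shows "real s * frac_value (s * t) x = real (x 1 div t) + frac_value (s * t) (mult_step s t x)"
proof -
  define n where "n = s * t"
  have n1: "n > 1" using n by (simp add: n_def)
  then have n0: "real n \<noteq> 0" by simp
  \<comment> \<open>Since \<open>s * a = (a div t) * n + (a mod t) * s\<close>, \<open>A\<close>
    collects the parts that move one place to the left and \<open>C\<close> those that stay. The
    product has terms \<open>C i + A (Suc i)\<close>, while \<open>A 0\<close> crosses the
    point.\<close>
  define A where "A i = real (x (int i + 1) div t) / real n ^ i" for i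
  define C where "C i = real ((x (int i + 1) mod t) * s) / real n / real n ^ i" for i
  have t0: "t > 0" using n by (cases t) auto
  have less: "x j < n" for j using x by (simp add: full_shift_digits_iff n_def)
  have sA: "summable A"
    unfolding A_def using n1 less
    by (intro summable_bounded_digits[where K = n])
       (auto intro: order_trans[OF div_le_dividend] less_imp_le)
  have sC: "summable C"
    unfolding C_def
  proof (intro summable_bounded_digits[where K = 1] n1)
    fix i
    have "(x (int i + 1) mod t) * s \<le> n"
      using t0 by (simp add: n_def mult.commute)
    then have "real ((x (int i + 1) mod t) * s) \<le> real n" by (rule of_nat_mono)
    then show "real ((x (int i + 1) mod t) * s) / real n \<le> 1"
      using n1 by (simp add: divide_le_eq)
  qed simp
  have "real s * frac_value n x = (\<Sum>i. real s * (real (x (int i + 1)) / real n ^ (i + 1)))"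
    unfolding frac_value_def using x n1
    by (intro suminf_mult[symmetric] summable_frac_value) (simp_all add: n_def)
  also have "\<dots> = (\<Sum>i. A i + C i)"
  proof (rule suminf_cong)
    fix i
    let ?a = "x (int i + 1)"
    have "s * ?a = s * (?a div t * t + ?a mod t)" by simp
    then have "s * ?a = (?a div t) * n + (?a mod t) * s" by (simp only: n_def algebra_simps)
    then have "real s * real ?a = real (?a div t) * real n + real ((?a mod t) * s)"
      by (metis of_nat_add of_nat_mult)
    then have "real s * (real ?a / real n ^ (i + 1))
        = (real (?a div t) * real n + real ((?a mod t) * s)) / real n ^ (i + 1)" by simp
    then show "real s * (real ?a / real n ^ (i + 1)) = A i + C i"
      using n0 by (simp add: A_def C_def add_divide_distrib)
  qed
  also have "\<dots> = suminf A + suminf C" using sA sC by (simp add: suminf_add)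
  finally have 1: "real s * frac_value n x = suminf A + suminf C" .
  have "frac_value n (mult_step s t x) = (\<Sum>i. C i + A (Suc i))"
    unfolding frac_value_def
  proof (rule suminf_cong)
    fix i
    show "real (mult_step s t x (int i + 1)) / real n ^ (i + 1) = C i + A (Suc i)"
      by (simp add: mult_step_def mult_g_def A_def C_def add_divide_distrib algebra_simps)
  qed
  also have "\<dots> = suminf C + (\<Sum>i. A (Suc i))"
    using sA sC by (intro suminf_add[symmetric]) (simp_all add: summable_Suc_iff)
  also have "\<dots> = suminf C + suminf A - A 0"
    using suminf_split_head[OF sA] by simp
  finally show ?thesis using 1 by (simp add: n_def A_def)
qed

lemma frac_value_shift_right:
  assumes x: "x \<in> full_shift (digits n)" and n: "n > 1"
  shows "real n * frac_value n (\<lambda>i. x (i - 1)) = real (x 0) + frac_value n x"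
proof -
  define B where "B i = real (x (int i)) / real n ^ i" for i
  have sB: "summable B"
    unfolding B_def using n x
    by (intro summable_bounded_digits[where K = n]) (auto simp: full_shift_digits_iff less_imp_le)
  have B: "(\<lambda>i. real (x (int i)) / real n ^ (i + 1)) = (\<lambda>i. B i / real n)"
    by (simp add: B_def mult.commute)
  have "frac_value n (\<lambda>i. x (i - 1)) = suminf B / real n"
    using suminf_divide[OF sB, of "real n"] by (simp add: frac_value_def B[simplified])
  moreover have "frac_value n x = (\<Sum>i. B (Suc i))"
    by (simp add: frac_value_def B_def add.commute)
  ultimately show ?thesis
    using suminf_split_head[OF sB] n by (simp add: B_def)
qed

lemma frac_value_mult_automaton:
  assumes x: "x \<in> full_shift (digits (s * t))" and n: "s * t > 1"
  shows "real t * frac_value (s * t) (mult_automaton s t x)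
       = real s * frac_value (s * t) x - real_of_int (mult_carry s t x)"
proof -
  let ?v = "frac_value (s * t)" and ?y = "mult_step s t x"
  let ?z = "mult_step s t ?y"
  have y: "?y \<in> full_shift (digits (s * t))" and z: "?z \<in> full_shift (digits (s * t))"
    using mult_step_full_shift x by blast+
  have "mult_automaton s t x = (\<lambda>i. ?z (i - 1))"
    by (simp add: fun_eq_iff mult_automaton_eq_mult_step)
  then have "real (s * t) * ?v (mult_automaton s t x) = real (?z 0) + ?v ?z"
    using frac_value_shift_right[OF z n] by simp
  also have "\<dots> = real (?z 0) + real s * ?v ?y - real (?y 1 div t)"
    using frac_value_mult_step[OF y n] by simp
  \<comment> \<open>The summand \<open>?y 1 div t\<close> cancels the integer part lost in the
    second multiplication, so \<open>s\<close> can be divided out.\<close>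
  also have "real (?z 0) = real s * real (?y 0 mod t) + real (?y 1 div t)"
    by (simp add: mult_step_def[of s t ?y] mult_g_def)
  finally have "real s * (real t * ?v (mult_automaton s t x)) = real s * (real (?y 0 mod t) + ?v ?y)"
    by (simp add: algebra_simps)
  moreover have "real s \<noteq> 0" using n by (cases s) auto
  ultimately have "real t * ?v (mult_automaton s t x) = real (?y 0 mod t) + ?v ?y" by simp
  then show ?thesis
    using frac_value_mult_step[OF x n] by (simp add: mult_carry_def)
qed

section \<open>Congruences and bounds determining the carry\<close>

lemma cong_mult_carry_right: "[mult_carry s t x = - int s * int (x 0)] (mod int t)"
proof -
  have "mult_carry s t x = int (x 1 div t) - int (mult_step s t x 0) mod int t"
    by (simp add: mult_carry_def zmod_int)
  also have "[\<dots> = int (x 1 div t) - int (mult_step s t x 0)] (mod int t)"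
    by (simp add: cong_def mod_diff_right_eq)
  \<comment> \<open>The contribution of \<open>x 1\<close> cancels, so modulo \<open>t\<close> only
    \<open>x 0\<close> matters.\<close>
  also have "int (x 1 div t) - int (mult_step s t x 0) = - int s * (int (x 0) mod int t)"
    by (simp add: mult_step_def mult_g_def zmod_int algebra_simps)
  also have "[\<dots> = - int s * int (x 0)] (mod int t)"
    by (intro cong_mult cong_refl) (simp add: cong_def)
  finally show ?thesis .
qed

text \<open>Modulo \<open>s\<close>, \<open>x 1 div t\<close> may be replaced by the whole digit
  \<open>mult_step s t x 0\<close>. Subtracting its remainder leaves \<open>t\<close> times its
  quotient by \<open>t\<close>, which the next letter reveals modulo \<open>s\<close>.\<close>

lemma cong_mult_carry_left: "[mult_carry s t x = int t * int (mult_automaton s t x 0)] (mod int s)"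
proof -
  let ?y = "mult_step s t x"
  have z: "mult_automaton s t x 0 = (?y (- 1) mod t) * s + ?y 0 div t"
    by (simp add: mult_automaton_eq_mult_step mult_step_def[of s t ?y] mult_g_def)
  have "[int (x 1 div t) = int (x 0 mod t) * int s + int (x 1 div t)] (mod int s)"
    by (simp add: cong_def)
  also have "int (x 0 mod t) * int s + int (x 1 div t) = int (?y 0)"
    by (simp add: mult_step_def mult_g_def)
  finally have "[int (x 1 div t) - int (?y 0 mod t) = int (?y 0) - int (?y 0 mod t)] (mod int s)"
    by (intro cong_diff cong_refl)
  also have "int (?y 0) - int (?y 0 mod t) = int t * int (?y 0 div t)"
    by (metis add_diff_cancel_right' mult_div_mod_eq of_nat_add of_nat_mult)
  also have "[\<dots> = int t * int (mult_automaton s t x 0)] (mod int s)"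
    by (intro cong_mult cong_refl) (simp add: z cong_def)
  finally show ?thesis by (simp add: mult_carry_def)
qed

lemma mult_carry_bounds:
  assumes "x \<in> full_shift (digits (s * t))" "t > 0"
  shows "- int t < mult_carry s t x" "mult_carry s t x < int s"
proof -
  have "x 1 div t < s" using assms by (simp add: full_shift_digits_iff less_mult_imp_div_less)
  moreover have "mult_step s t x 0 mod t < t" using assms(2) by simp
  ultimately show "- int t < mult_carry s t x" "mult_carry s t x < int s"
    unfolding mult_carry_def by linarith+
qed

text \<open>By coprimality the carries agree modulo \<open>s * t\<close>, and they lie in an
  interval too short for a nonzero multiple of \<open>s * t\<close>.\<close>

lemma mult_carry_unique:
  assumes x: "x \<in> full_shift (digits (s * t))" and y: "y \<in> full_shift (digits (s * t))"
    and st: "s > 1" "t > 1" "coprime s t"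
    and eq: "x 0 = y 0" "mult_automaton s t x 0 = mult_automaton s t y 0"
  shows "mult_carry s t x = mult_carry s t y"
proof -
  let ?d = "mult_carry s t x - mult_carry s t y"
  have "[mult_carry s t x = mult_carry s t y] (mod int t)"
    using cong_mult_carry_right[of s t x] cong_mult_carry_right[of s t y] eq(1)
    by (metis cong_sym cong_trans)
  moreover have "[mult_carry s t x = mult_carry s t y] (mod int s)"
    using cong_mult_carry_left[of s t x] cong_mult_carry_left[of s t y] eq(2)
    by (metis cong_sym cong_trans)
  ultimately have "int s * int t dvd ?d"
    using st(3) by (intro divides_mult) (auto simp: cong_iff_dvd_diff)
  moreover have "\<bar>?d\<bar> < int s * int t"
  proof -
    have "\<bar>?d\<bar> \<le> int s + int t - 2"
      using mult_carry_bounds[OF x] mult_carry_bounds[OF y] st by linarith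
    also have "\<dots> < int s * int t"
    proof -
      have "0 \<le> (int s - 1) * (int t - 1)" using st by simp
      then show ?thesis by (simp add: algebra_simps)
    qed
    finally show ?thesis .
  qed
  ultimately have "?d = 0" using zdvd_imp_le[of "int s * int t" "\<bar>?d\<bar>"] by fastforce
  then show ?thesis by simp
qed

section \<open>Orbits with a common trace\<close>

lemma funpow_mult_automaton_full_shift:
  assumes "x \<in> full_shift (digits (s * t))"
  shows "(mult_automaton s t ^^ k) x \<in> full_shift (digits (s * t))"
  using assms by (induction k) (auto intro: mult_automaton_full_shift)

text \<open>Equal consecutive letters force equal carries, which cancel in the difference. The
  \<open>m\<close> carries need \<open>m + 1\<close> common letters.\<close>

lemma frac_value_diff_expand:
  assumes x: "x \<in> full_shift (digits (s * t))" and y: "y \<in> full_shift (digits (s * t))"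
    and st: "s > 1" "t > 1" "coprime s t"
    and eq: "\<And>k. k \<le> m \<Longrightarrow> (mult_automaton s t ^^ k) x 0 = (mult_automaton s t ^^ k) y 0"
  shows "frac_value (s * t) ((mult_automaton s t ^^ m) x)
           - frac_value (s * t) ((mult_automaton s t ^^ m) y)
       = (real s / real t) ^ m * (frac_value (s * t) x - frac_value (s * t) y)"
  using eq
proof (induction m)
  case (Suc m)
  let ?v = "frac_value (s * t)" and ?F = "mult_automaton s t"
  let ?x = "(?F ^^ m) x" and ?y = "(?F ^^ m) y"
  have x': "?x \<in> full_shift (digits (s * t))" and y': "?y \<in> full_shift (digits (s * t))"
    using x y funpow_mult_automaton_full_shift by blast+
  have n: "s * t > 1" using st less_1_mult[of s t] by simp_all
  have "mult_carry s t ?x = mult_carry s t ?y"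
    using Suc.prems[of m] Suc.prems[of "Suc m"] by (intro mult_carry_unique x' y' st) auto
  then have "real t * (?v (?F ?x) - ?v (?F ?y)) = real s * (?v ?x - ?v ?y)"
    using frac_value_mult_automaton[OF x' n] frac_value_mult_automaton[OF y' n]
    by (simp add: algebra_simps)
  then have "?v (?F ?x) - ?v (?F ?y) = real s / real t * (?v ?x - ?v ?y)"
    using st by (simp add: field_simps)
  then show ?case using Suc by simp
qed simp

section \<open>The orbit of the number one\<close>

text \<open>An integer start has fractional value 0, the least possible, which makes the later
  comparison one-sided.\<close>

definition one_expansion :: "int \<Rightarrow> nat" where
  "one_expansion i = (if i = 0 then 1 else 0)"

lemma frac_value_one_expansion: "frac_value n one_expansion = 0"
  by (simp add: frac_value_def one_expansion_def)

lemma one_expansion_full_shift: "n > 1 \<Longrightarrow> one_expansion \<in> full_shift (digits n)"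
  by (simp add: full_shift_digits_iff one_expansion_def)

text \<open>In each step the numerator \<open>a\<close> becomes \<open>s * a\<close> minus a
  multiple of \<open>t\<close>, so it stays a unit modulo \<open>t\<close>. Time 0 is left out
  because its numerator is 0.\<close>

lemma frac_value_orbit_one:
  assumes st: "s > 1" "t > 1" "coprime s t"
  shows "\<exists>a. real t ^ Suc k * frac_value (s * t) ((mult_automaton s t ^^ Suc k) one_expansion)
           = real_of_int a \<and> coprime a (int t)"
proof (induction k)
  have n: "s * t > 1" using st less_1_mult[of s t] by simp_all
  note one = one_expansion_full_shift[OF n]
  {
    case 0
    have "[- int s = mult_carry s t one_expansion] (mod int t)"
      using cong_sym[OF cong_mult_carry_right[of s t one_expansion]]
      by (simp add: one_expansion_def)
    then have "coprime (mult_carry s t one_expansion) (int t)"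
      using st(3) by (auto dest: cong_imp_coprime)
    then have "coprime (- mult_carry s t one_expansion) (int t)" by simp
    then show ?case
      using frac_value_mult_automaton[OF one n]
      by (intro exI[of _ "- mult_carry s t one_expansion"]) (simp add: frac_value_one_expansion)
  next
    case (Suc k)
    let ?x = "(mult_automaton s t ^^ Suc k) one_expansion"
    let ?e = "mult_carry s t ?x"
    obtain a where a: "real t ^ Suc k * frac_value (s * t) ?x = real_of_int a" "coprime a (int t)"
      using Suc by blast
    have "real t ^ Suc (Suc k) * frac_value (s * t) (mult_automaton s t ?x)
        = real t ^ Suc k * (real t * frac_value (s * t) (mult_automaton s t ?x))" by simp
    also have "\<dots> = real s * (real t ^ Suc k * frac_value (s * t) ?x) - real t ^ Suc k * real_of_int ?e"
      by (subst frac_value_mult_automaton[OF funpow_mult_automaton_full_shift[OF one] n])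
         (simp add: algebra_simps)
    also have "\<dots> = real_of_int (int s * a - int t ^ Suc k * ?e)"
      unfolding a(1) by simp
    finally have "real t ^ Suc (Suc k) * frac_value (s * t) (mult_automaton s t ?x)
        = real_of_int (int s * a - int t ^ Suc k * ?e)" .
    moreover have "coprime (int s * a - int t ^ Suc k * ?e) (int t)"
    proof -
      have "coprime (int s * a) (int t)" using a(2) st(3) by simp
      moreover have "[int s * a = int s * a - int t ^ Suc k * ?e] (mod int t)"
        by (simp add: cong_iff_dvd_diff)
      ultimately show ?thesis by (rule cong_imp_coprime[rotated])
    qed
    ultimately show ?case by (metis funpow.simps(2) comp_apply)
  }
qed

lemma frac_value_orbit_one_neq:
  assumes st: "s > 1" "t > 1" "coprime s t" and ij: "i < j"
  shows "frac_value (s * t) ((mult_automaton s t ^^ i) one_expansion)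
       \<noteq> frac_value (s * t) ((mult_automaton s t ^^ j) one_expansion)"
proof
  let ?f = "\<lambda>k. frac_value (s * t) ((mult_automaton s t ^^ k) one_expansion)"
  assume eq: "?f i = ?f j"
  obtain b where b: "real t ^ j * ?f j = real_of_int b" "coprime b (int t)"
    using frac_value_orbit_one[OF st, of "j - 1"] ij by auto
  obtain a where a: "real t ^ i * ?f i = real_of_int a"
  proof (cases i)
    case 0
    then show ?thesis using that[of 0] by (simp add: frac_value_one_expansion)
  next
    case (Suc k)
    then show ?thesis using that frac_value_orbit_one[OF st, of k] by blast
  qed
  \<comment> \<open>At equal values the numerator at time \<open>j\<close> would contain the factor
    \<open>t^(j - i)\<close>.\<close>
  have "real_of_int b = real t ^ (j - i) * (real t ^ i * ?f i)"
    using b(1) eq ij by (simp add: mult.assoc[symmetric] power_add[symmetric])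
  then have "real_of_int b = real_of_int (int t ^ (j - i) * a)" using a by simp
  then have "b = int t ^ (j - i) * a" by (simp only: of_int_eq_iff)
  moreover have "int t dvd int t ^ (j - i)" using ij by (intro dvd_power) simp
  ultimately have "int t dvd b" by simp
  then have "is_unit (int t)" using b(2) by (metis coprime_common_divisor dvd_refl)
  then show False using st(2) by simp
qed

section \<open>Non-regularity of the trace language\<close>

text \<open>The window is half-open: letter \<open>j\<close> is excluded, so equality of letters at
  a cut must be supplied separately.\<close>

definition trace_word :: "nat \<Rightarrow> nat \<Rightarrow> (int \<Rightarrow> nat) \<Rightarrow> nat \<Rightarrow> nat \<Rightarrow> nat list" where
  "trace_word s t x i j = map (\<lambda>k. (mult_automaton s t ^^ k) x 0) [i..<j]"

lemma trace_word_append: "i \<le> j \<Longrightarrow> j \<le> k \<Longrightarrow> trace_word s t x i j @ trace_word s t x j k = trace_word s t x i k"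
  unfolding trace_word_def by (metis le_Suc_ex map_append upt_add_eq_append)

lemma language_trace_subshift:
  "language (trace_subshift s t) = {trace_word s t x 0 n | x n. x \<in> full_shift (digits (s * t))}"
    (is "?L = ?R")
proof
  show "?L \<subseteq> ?R"
  proof
    fix w assume "w \<in> ?L"
    then obtain x i n where x: "x \<in> full_shift (digits (s * t))"
      and w: "w = map (\<lambda>k. mult_trace s t x (i + int k)) [0..<n]"
      by (auto simp: language_def trace_subshift_def)
    obtain y where "y \<in> full_shift (digits (s * t))"
      "\<And>k. mult_trace s t x (i + int k) = (mult_automaton s t ^^ k) y 0"
      using mult_trace_window[OF x] by blast
    then show "w \<in> ?R" using w by (auto simp: trace_word_def)
  qed
  show "?R \<subseteq> ?L"
  proof
    fix w assume "w \<in> ?R"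
    then obtain x n where x: "x \<in> full_shift (digits (s * t))" and w: "w = trace_word s t x 0 n"
      by blast
    have "w = map (\<lambda>k. mult_trace s t x (0 + int k)) [0..<n]"
      by (simp add: w trace_word_def mult_trace_def int_iterate_def)
    then show "w \<in> ?L" using x unfolding language_def trace_subshift_def by blast
  qed
qed

lemma not_in_language_trace_subshift:
  assumes st: "s > t" "t > 1" "coprime s t"
    and less: "frac_value (s * t) ((mult_automaton s t ^^ i) one_expansion)
             < frac_value (s * t) ((mult_automaton s t ^^ j) one_expansion)"
    and letter: "(mult_automaton s t ^^ i) one_expansion 0 = (mult_automaton s t ^^ j) one_expansion 0"
  obtains m where "trace_word s t one_expansion 0 j @ trace_word s t one_expansion i (i + m)
                    \<notin> language (trace_subshift s t)"
proof -
  let ?F = "mult_automaton s t" and ?v = "frac_value (s * t)" and ?o = one_expansion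
  let ?X = "full_shift (digits (s * t))"
  have s: "s > 1" and n: "s * t > 1" using st less_1_mult[of s t] by simp_all
  note o = one_expansion_full_shift[OF n]
  define d where "d = ?v ((?F ^^ j) ?o) - ?v ((?F ^^ i) ?o)"
  have d: "d > 0" using less by (simp add: d_def)
  have "real s / real t > 1" using st by simp
  \<comment> \<open>After \<open>m\<close> expansions a gap of at least \<open>d\<close> exceeds 1,
    the largest difference of two fractional values.\<close>
  then obtain m where m: "(real s / real t) ^ m > 1 / d"
    using real_arch_pow by blast
  \<comment> \<open>Comparing over \<open>m\<close> expansions takes \<open>m + 1\<close> letters,
    hence \<open>Suc m\<close>.\<close>
  let ?w = "trace_word s t ?o 0 j @ trace_word s t ?o i (i + Suc m)"
  have "?w \<notin> language (trace_subshift s t)"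
  proof
    assume "?w \<in> language (trace_subshift s t)"
    then obtain x k where x: "x \<in> ?X" and w: "?w = trace_word s t x 0 k"
      unfolding language_trace_subshift by blast
    have k: "k = j + Suc m" using arg_cong[OF w, of length] by (simp add: trace_word_def)
    have "trace_word s t x 0 j @ trace_word s t x j k = ?w"
      using w k by (simp add: trace_word_append)
    then have w1: "trace_word s t x 0 j = trace_word s t ?o 0 j"
      and w2: "trace_word s t x j k = trace_word s t ?o i (i + Suc m)"
      by (simp_all add: append_eq_append_conv trace_word_def)
    have tail: "(?F ^^ l) ((?F ^^ j) x) 0 = (?F ^^ l) ((?F ^^ i) ?o) 0" if "l \<le> m" for l
      using arg_cong[OF w2, of "\<lambda>u. u ! l"] that k
      by (simp add: trace_word_def funpow_add[symmetric, THEN fun_cong, simplified] add.commute del: upt_Suc)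
    \<comment> \<open>Time \<open>j\<close> lies outside the first block. Its letter opens the
      second block, so it is letter \<open>i\<close> of the orbit of one, which
      \<open>letter\<close> identifies with letter \<open>j\<close>.\<close>
    have head: "(?F ^^ l) x 0 = (?F ^^ l) ?o 0" if "l \<le> j" for l
    proof (cases "l < j")
      case True
      then show ?thesis using arg_cong[OF w1, of "\<lambda>u. u ! l"] by (simp add: trace_word_def)
    next
      case False
      then show ?thesis using tail[of 0] letter that by simp
    qed
    have "?v ((?F ^^ j) x) - ?v ((?F ^^ j) ?o) = (real s / real t) ^ j * (?v x - ?v ?o)"
      by (rule frac_value_diff_expand[OF x o s st(2,3) head])
    \<comment> \<open>The reference orbit starts at value 0, so the difference cannot be
      negative.\<close>
    also have "\<dots> \<ge> 0"
      using frac_value_nonneg[OF x n] by (simp add: frac_value_one_expansion)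
    finally have "d \<le> ?v ((?F ^^ j) x) - ?v ((?F ^^ i) ?o)" by (simp add: d_def)
    then have "(real s / real t) ^ m * d
        \<le> (real s / real t) ^ m * (?v ((?F ^^ j) x) - ?v ((?F ^^ i) ?o))"
      by (intro mult_left_mono) auto
    also have "\<dots> = ?v ((?F ^^ m) ((?F ^^ j) x)) - ?v ((?F ^^ m) ((?F ^^ i) ?o))"
      by (rule frac_value_diff_expand[symmetric])
         (use tail x o s st(2,3) funpow_mult_automaton_full_shift in auto)
    also have "\<dots> \<le> 1"
      using frac_value_le_1[of "(?F ^^ m) ((?F ^^ j) x)" "s * t"]
        frac_value_nonneg[of "(?F ^^ m) ((?F ^^ i) ?o)" "s * t"] n x o
      by (simp add: funpow_mult_automaton_full_shift)
    finally show False using m d by (simp add: field_simps)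
  qed
  then show ?thesis using that by blast
qed

section \<open>Pigeonhole on the states of a finite automaton\<close>

lemma foldl_in_states:
  assumes "q \<in> Q" "\<forall>q\<in>Q. \<forall>a\<in>A. \<delta> q a \<in> Q" "w \<in> lists A"
  shows "foldl \<delta> q w \<in> Q"
  using assms(3,1) by (induction arbitrary: q) (use assms(2) in auto)

lemma trace_subshift_not_sofic:
  assumes st: "s > t" "t > 1" "coprime s t"
  shows "\<not> sofic (digits (s * t)) (trace_subshift s t)"
proof
  let ?F = "mult_automaton s t" and ?v = "frac_value (s * t)" and ?o = one_expansion
  let ?D = "digits (s * t)"
  let ?L = "language (trace_subshift s t)"
  have s: "s > 1" and n: "s * t > 1" using st less_1_mult[of s t] by simp_all
  note o = one_expansion_full_shift[OF n]
  assume "sofic ?D (trace_subshift s t)"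
  then obtain Q :: "nat set" and \<delta> q\<^sub>0 A where Q: "finite Q" "q\<^sub>0 \<in> Q" "\<forall>q\<in>Q. \<forall>a\<in>?D. \<delta> q a \<in> Q"
    and L: "?L = {w \<in> lists ?D. foldl \<delta> q\<^sub>0 w \<in> A}"
    unfolding sofic_def regular_language_def by metis
  have letter: "(?F ^^ k) ?o 0 \<in> ?D" for k
    using funpow_mult_automaton_full_shift[OF o] by (simp add: full_shift_def)
  then have word: "trace_word s t ?o i j \<in> lists ?D" for i j
    by (auto simp: trace_word_def)
  \<comment> \<open>The next letter is recorded beside the state, since the cut needs equal letters
    at both times; the pairs still range over a finite set.\<close>
  define \<phi> where "\<phi> k = (foldl \<delta> q\<^sub>0 (trace_word s t ?o 0 k), (?F ^^ k) ?o 0)" for k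
  have "range \<phi> \<subseteq> Q \<times> ?D"
    using foldl_in_states[OF Q(2,3) word] letter by (auto simp: \<phi>_def)
  then have "finite (range \<phi>)" using Q(1) by (auto intro: finite_subset simp: digits_def)
  then obtain k l where "\<phi> k = \<phi> l" "k \<noteq> l"
    using finite_imageD[of \<phi> UNIV] unfolding inj_on_def by auto
  moreover have "?v ((?F ^^ k) ?o) \<noteq> ?v ((?F ^^ l) ?o)"
    using frac_value_orbit_one_neq[OF s st(2,3), of k l]
      frac_value_orbit_one_neq[OF s st(2,3), of l k] \<open>k \<noteq> l\<close> by (metis nat_neq_iff)
  \<comment> \<open>The names are chosen so that \<open>i\<close> has the smaller fractional value;
    the order of \<open>i\<close> and \<open>j\<close> as times is left open.\<close>
  ultimately obtain i j where \<phi>: "\<phi> i = \<phi> j" and less: "?v ((?F ^^ i) ?o) < ?v ((?F ^^ j) ?o)"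
    by (metis linorder_neqE_linordered_idom)
  obtain m where m: "trace_word s t ?o 0 j @ trace_word s t ?o i (i + m) \<notin> ?L"
    using not_in_language_trace_subshift[OF st less] \<phi> by (auto simp: \<phi>_def)
  have "trace_word s t ?o 0 i @ trace_word s t ?o i (i + m) \<in> ?L"
    using o by (auto simp: language_trace_subshift trace_word_append)
  \<comment> \<open>Equal states after the two prefixes give the same verdict once the common suffix
    is appended, yet only one of the two words is in the language.\<close>
  then show False
    using m \<phi> word by (simp add: L \<phi>_def)
qed

section \<open>The trace subshift as a factor\<close>

lemma compact_full_shift: "finite A \<Longrightarrow> compact (full_shift (A :: 'a::discrete_topology set))"
proof -
  assume A: "finite A"
  have "compactin (product_topology (\<lambda>_::int. euclidean) UNIV) (PiE UNIV (\<lambda>_. A))"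
    by (metis compactin_PiE compactin_euclidean_iff finite_imp_compact[OF A])
  moreover have "PiE UNIV (\<lambda>_::int. A) = full_shift A"
    by (auto simp: full_shift_def PiE_UNIV_domain)
  ultimately show ?thesis by (simp add: euclidean_product_topology)
qed

text \<open>The type of functions into \<^typ>\<open>nat\<close> is not declared an instance of \<^class>\<open>t2_space\<close>.\<close>

lemma compact_imp_closed_fun:
  fixes S :: "('i \<Rightarrow> 'a::t2_space) set"
  assumes "compact S"
  shows "closed S"
proof -
  have "Hausdorff_space (euclidean :: 'a topology)"
    unfolding Hausdorff_space_def disjnt_def using separation_t2 by auto
  then have "Hausdorff_space (product_topology (\<lambda>_::'i. euclidean :: 'a topology) UNIV)"
    by (simp add: Hausdorff_space_product_topology)
  then have "Hausdorff_space (euclidean :: ('i \<Rightarrow> 'a) topology)"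
    by (simp only: euclidean_product_topology)
  then show ?thesis
    using compactin_imp_closedin[of euclidean S] assms by simp
qed

section \<open>Continuity of the trace map\<close>

lemma continuous_on_mult_step: "continuous_on X (mult_step s t)"
proof (rule continuous_on_coordinatewise_then_product)
  fix i
  have c: "continuous_on X (\<lambda>x::int \<Rightarrow> nat. h (x j))" for h :: "nat \<Rightarrow> nat" and j
    by (rule continuous_on_compose2[OF Topological_Spaces.continuous_on_discrete
          continuous_on_subset[OF continuous_on_product_coordinates]]) auto
  show "continuous_on X (\<lambda>x. mult_step s t x i)"
    unfolding mult_step_def mult_g_def by (intro continuous_on_add c[of "\<lambda>a. a mod t * s"] c[of "\<lambda>b. b div t"])
qed

lemma continuous_on_mult_automaton: "continuous_on X (mult_automaton s t)"
proof (rule continuous_on_coordinatewise_then_product)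
  fix i
  have "continuous_on X (\<lambda>x. mult_step s t (mult_step s t x))"
    by (rule continuous_on_compose2[OF continuous_on_mult_step continuous_on_mult_step subset_UNIV])
  then show "continuous_on X (\<lambda>x. mult_automaton s t x i)"
    unfolding mult_automaton_eq_mult_step by (rule continuous_on_product_then_coordinatewise)
qed

lemma continuous_on_funpow:
  assumes "continuous_on X f" "f ` X \<subseteq> X"
  shows "continuous_on X (f ^^ m)"
proof (induction m)
  case (Suc m)
  have "(f ^^ m) ` X \<subseteq> X"
    using assms(2) by (induction m) auto
  then show ?case
    using Suc assms(1) by (auto intro!: continuous_on_compose intro: continuous_on_subset simp del: o_apply simp: funpow.simps)
qed (simp add: id_def)

lemma continuous_on_mult_trace:
  "continuous_on (full_shift (digits (s * t))) (mult_trace s t)"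
proof (rule continuous_on_coordinatewise_then_product)
  fix k
  let ?X = "full_shift (digits (s * t))"
  let ?I = "inv_into ?X (mult_automaton s t)"
  have I: "?I ` ?X \<subseteq> ?X"
    using bij_betw_inv_into[OF mult_automaton_bij] by (simp add: bij_betw_def)
  \<comment> \<open>On the full shift the inverse is the automaton with \<open>s\<close> and
    \<open>t\<close> exchanged.\<close>
  have "continuous_on ?X ?I"
    using continuous_on_mult_automaton
    by (rule continuous_on_eq) (simp add: inv_into_mult_automaton)
  then have "continuous_on ?X (int_iterate ?X (mult_automaton s t) k)"
    unfolding int_iterate_def using I mult_automaton_full_shift[of _ s t]
    by (cases "k \<ge> 0") (auto intro!: continuous_on_funpow continuous_on_mult_automaton)
  then show "continuous_on ?X (\<lambda>x. mult_trace s t x k)"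
    unfolding mult_trace_def by (rule continuous_on_product_then_coordinatewise)
qed

lemma mult_trace_mult_automaton:
  assumes "x \<in> full_shift (digits (s * t))"
  shows "mult_trace s t (mult_automaton s t x) = shift (mult_trace s t x)"
  using int_iterate_commute[OF mult_automaton_bij assms] int_iterate_succ[OF mult_automaton_bij assms]
  by (simp add: mult_trace_def shift_def)

lemma subshift_trace_subshift:
  assumes "s * t > 0"
  shows "subshift (digits (s * t)) (trace_subshift s t)"
proof -
  let ?X = "full_shift (digits (s * t))" and ?F = "mult_automaton s t"
  have "(\<lambda>_. 0) \<in> ?X" using assms by (simp add: full_shift_digits_iff)
  then have "trace_subshift s t \<noteq> {}" by (auto simp: trace_subshift_def)
  moreover have "trace_subshift s t \<subseteq> ?X"
    using int_iterate_closed[OF mult_automaton_bij]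
    by (auto simp: trace_subshift_def mult_trace_def full_shift_digits_iff)
  moreover have "closed (trace_subshift s t)"
    unfolding trace_subshift_def
    by (intro compact_imp_closed_fun compact_continuous_image continuous_on_mult_trace
        compact_full_shift) (simp add: digits_def)
  \<comment> \<open>Shifting a trace amounts to tracing the image configuration, and the automaton
    permutes the full shift.\<close>
  moreover have "shift ` trace_subshift s t = mult_trace s t ` ?F ` ?X"
    unfolding trace_subshift_def image_image by (simp add: mult_trace_mult_automaton)
  then have "shift ` trace_subshift s t = trace_subshift s t"
    using mult_automaton_bij[of s t] by (simp add: bij_betw_def trace_subshift_def)
  ultimately show ?thesis by (simp add: subshift_def digits_def)
qed

theorem corollary3p19:
  fixes p q :: nat
  assumes "p > q" and "q > 1" and "coprime p q"
  shows "\<not> sofic (digits (p * q)) (trace_subshift p q) \<and>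
         \<not> regular_CA (full_shift (digits (p * q))) (mult_automaton p q)"
proof -
  \<comment> \<open>The trace map is itself the factor map, so a regular automaton would have a
    sofic trace subshift.\<close>
  have "subshift_factor (full_shift (digits (p * q))) (mult_automaton p q)
          (digits (p * q)) (trace_subshift p q)"
    unfolding subshift_factor_def
    using assms subshift_trace_subshift[of p q] continuous_on_mult_trace[of p q]
    by (auto simp: trace_subshift_def mult_trace_mult_automaton)
  then show ?thesis
    using trace_subshift_not_sofic[OF assms] by (auto simp: regular_CA_def)
qed

end
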